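(* Let $\gamma$ be an isoparametric string with (constant) bending $\kappa$ and twist $\tau$. Then $D_{\kappa,\tau}>0$, where $$D_{\kappa,\tau}=-27+108\kappa(\kappa^2+\tau)-324\kappa^4\tau-72\kappa^2\tau^2-4\tau^3.$$
   Context: $\mathbb C^{2,1}$ is $\mathbb C^3$ with the Hermitian form $\langle \mathbf z,\mathbf w\rangle={}^t\overline{\mathbf z}\,\mathbf h\,\mathbf w$, $\mathbf h=\begin{pmatrix}0&0&i\\0&1&0\\-i&0&0\end{pmatrix}$. $\mathcal N$ is the set of nonzero null vectors and $\mathcal S=\{[\mathbf z]\in\mathbb{CP}^2:\langle\mathbf z,\mathbf z\rangle=0\}$, with contact form $\zeta$ equal to the restriction to $T\mathcal S$ of $-i\langle\mathbf z,d\mathbf z\rangle/({}^t\overline{\mathbf z}\mathbf z)$. A lift of a smooth curve $\gamma:J\to\mathcal S$ ($J$ an interval) is a smooth map $\Gamma:J\to\mathcal N$ with $\gamma=[\Gamma]$. $\gamma$ is transversal if $\zeta(\gamma')\ne0$ everywhere; transversal curves are always assumed positively parametrized, $-i\langle\Gamma,\Gamma'\rangle>0$. $\gamma$ is generic if $\det(\Gamma,\Gamma',\Gamma'')$ is nowhere zero. A Wilczynski lift is a lift with $\det(\Gamma,\Gamma',\Gamma'')=-1$. The parametrization is natural if $i\langle\Gamma,\Gamma'\rangle^{-1}=1$ for a Wilczynski lift $\Gamma$; then the bending and twist are $\kappa=\frac12\langle\Gamma',\Gamma'\rangle$ and $\tau=\mathrm{Im}\langle\Gamma'',\Gamma'\rangle+3\kappa^2$.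 A generic transversal curve is isoparametric if its bending and twist are constant (natural parametrizations are taken on all of $\mathbb R$). A closed (i.e. periodic) isoparametric curve is called an isoparametric string. $D_{\kappa,\tau}$ is the discriminant of the characteristic polynomial $-t^3+(3\kappa^2-\tau)t+2\kappa^3+2\kappa\tau-1$ of $\mathrm H_{\kappa,\tau}=i\begin{pmatrix}i\kappa&-i&\tau\\0&-2i\kappa&1\\1&0&i\kappa\end{pmatrix}$. *)

theory Defs
  imports "HOL-Analysis.Analysis" "HOL-Computational_Algebra.Polynomial"
begin

definition herm_matrix :: "complex^3^3" where
  "herm_matrix = vector [vector [0, 0, \<i>], vector [0, 1, 0], vector [- \<i>, 0, 0]]"

text \<open>Antilinear in the first argument, linear in the second.\<close>
definition herm :: "complex^3 \<Rightarrow> complex^3 \<Rightarrow> complex" where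
  "herm z w = (\<Sum>i\<in>UNIV. \<Sum>j\<in>UNIV. cnj (z $ i) * herm_matrix $ i $ j * w $ j)"

definition null_vectors :: "(complex^3) set" where
  "null_vectors = {z. z \<noteq> 0 \<and> herm z z = 0}"

text \<open>Points of the complex projective plane are encoded as equivalence classes of nonzero
  vectors under multiplication by nonzero scalars.\<close>
definition proj_class :: "complex^3 \<Rightarrow> (complex^3) set" where
  "proj_class z = {c *s z | c. c \<noteq> 0}"

definition hyperquadric :: "(complex^3) set set" where
  "hyperquadric = proj_class ` null_vectors"

text \<open>All curves have parameter interval \<open>\<real>\<close>.\<close>

definition curve_deriv :: "nat \<Rightarrow> (real \<Rightarrow> complex^3) \<Rightarrow> real \<Rightarrow> complex^3" where
  "curve_deriv n = (\<lambda>\<Gamma> t. vector_derivative \<Gamma> (at t)) ^^ n"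

text \<open>Intended for open \<open>U\<close>.\<close>
definition smooth_curve_on :: "real set \<Rightarrow> (real \<Rightarrow> complex^3) \<Rightarrow> bool" where
  "smooth_curve_on U \<Gamma> \<longleftrightarrow> (\<forall>n. \<forall>t\<in>U. curve_deriv n \<Gamma> differentiable (at t))"

text \<open>The standard affine charts: the chart domain \<open>z\<^sub>k \<noteq> 0\<close> is mapped to the affine plane
  \<open>z\<^sub>k = 1\<close> by taking the unique representative lying in that plane.\<close>
definition chart_domain :: "3 \<Rightarrow> (complex^3) set set" where
  "chart_domain k = {proj_class z | z. z $ k \<noteq> 0}"

definition affine_chart :: "3 \<Rightarrow> (complex^3) set \<Rightarrow> complex^3" where
  "affine_chart k p = (THE z. z \<in> p \<and> z $ k = 1)"

text \<open>As the hyperquadric is an embedded submanifold, smoothness of a curve in it can be tested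
  in the charts of the projective plane.\<close>
definition smooth_hyperquadric_curve :: "(real \<Rightarrow> (complex^3) set) \<Rightarrow> bool" where
  "smooth_hyperquadric_curve \<gamma> \<longleftrightarrow>
     (\<forall>t. \<gamma> t \<in> hyperquadric) \<and>
     (\<forall>t. \<exists>k. \<exists>e>0. \<gamma> ` ball t e \<subseteq> chart_domain k \<and>
        smooth_curve_on (ball t e) (\<lambda>s. affine_chart k (\<gamma> s)))"

definition is_lift :: "(real \<Rightarrow> complex^3) \<Rightarrow> (real \<Rightarrow> (complex^3) set) \<Rightarrow> bool" where
  "is_lift \<Gamma> \<gamma> \<longleftrightarrow> smooth_curve_on UNIV \<Gamma> \<and> (\<forall>t. \<Gamma> t \<in> null_vectors \<and> \<gamma> t = proj_class (\<Gamma> t))"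

text \<open>The pullback to the cone of null vectors of the contact form: \<open>contact_form (\<Gamma> t) (\<Gamma>' t)\<close>
  is the contact form evaluated on the velocity of the projected curve. It does not depend on
  the lift.\<close>
definition contact_form :: "complex^3 \<Rightarrow> complex^3 \<Rightarrow> complex" where
  "contact_form z v = - \<i> * herm z v / (\<Sum>i\<in>UNIV. cnj (z $ i) * z $ i)"

text \<open>Transversality includes the positivity of the parametrization. Along a lift
  \<open>- \<i> * \<langle>\<Gamma>, \<Gamma>'\<rangle>\<close> is automatically real. The conditions here and in the next definition hold
  for one lift iff they hold for every lift.\<close>
definition transversal :: "(real \<Rightarrow> (complex^3) set) \<Rightarrow> bool" where
  "transversal \<gamma> \<longleftrightarrow>
     (\<exists>\<Gamma>. is_lift \<Gamma> \<gamma> \<and>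
        (\<forall>t. contact_form (\<Gamma> t) (curve_deriv 1 \<Gamma> t) \<noteq> 0 \<and>
             Re (- \<i> * herm (\<Gamma> t) (curve_deriv 1 \<Gamma> t)) > 0))"

definition wronskian :: "(real \<Rightarrow> complex^3) \<Rightarrow> real \<Rightarrow> complex" where
  "wronskian \<Gamma> t = det (transpose (vector [\<Gamma> t, curve_deriv 1 \<Gamma> t, curve_deriv 2 \<Gamma> t]))"

definition generic :: "(real \<Rightarrow> (complex^3) set) \<Rightarrow> bool" where
  "generic \<gamma> \<longleftrightarrow> (\<exists>\<Gamma>. is_lift \<Gamma> \<gamma> \<and> (\<forall>t. wronskian \<Gamma> t \<noteq> 0))"

definition wilczynski_lift :: "(real \<Rightarrow> complex^3) \<Rightarrow> (real \<Rightarrow> (complex^3) set) \<Rightarrow> bool" where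
  "wilczynski_lift \<Gamma> \<gamma> \<longleftrightarrow> is_lift \<Gamma> \<gamma> \<and> (\<forall>t. wronskian \<Gamma> t = - 1)"

definition natural_lift :: "(real \<Rightarrow> complex^3) \<Rightarrow> (real \<Rightarrow> (complex^3) set) \<Rightarrow> bool" where
  "natural_lift \<Gamma> \<gamma> \<longleftrightarrow> wilczynski_lift \<Gamma> \<gamma> \<and>
     (\<forall>t. \<i> * inverse (herm (\<Gamma> t) (curve_deriv 1 \<Gamma> t)) = 1)"

text \<open>\<open>\<langle>z, z\<rangle>\<close> is always real.\<close>
definition bending :: "(real \<Rightarrow> complex^3) \<Rightarrow> real \<Rightarrow> real" where
  "bending \<Gamma> t = Re (herm (curve_deriv 1 \<Gamma> t) (curve_deriv 1 \<Gamma> t)) / 2"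

definition twist :: "(real \<Rightarrow> complex^3) \<Rightarrow> real \<Rightarrow> real" where
  "twist \<Gamma> t = Im (herm (curve_deriv 2 \<Gamma> t) (curve_deriv 1 \<Gamma> t)) + 3 * (bending \<Gamma> t)\<^sup>2"

text \<open>Wilczynski lifts are unique up to a constant cube root of unity, so the choice of \<open>\<Gamma>\<close> is
  immaterial: naturality, bending and twist depend on \<open>\<gamma>\<close> only.\<close>
definition isoparametric :: "(real \<Rightarrow> (complex^3) set) \<Rightarrow> real \<Rightarrow> real \<Rightarrow> bool" where
  "isoparametric \<gamma> \<kappa> \<tau> \<longleftrightarrow>
     smooth_hyperquadric_curve \<gamma> \<and> transversal \<gamma> \<and> generic \<gamma> \<and>
     (\<exists>\<Gamma>. natural_lift \<Gamma> \<gamma> \<and> (\<forall>t. bending \<Gamma> t = \<kappa> \<and> twist \<Gamma> t = \<tau>))"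

text \<open>Periodicity concerns the projective curve, not its lift.\<close>
definition isoparametric_string :: "(real \<Rightarrow> (complex^3) set) \<Rightarrow> real \<Rightarrow> real \<Rightarrow> bool" where
  "isoparametric_string \<gamma> \<kappa> \<tau> \<longleftrightarrow>
     isoparametric \<gamma> \<kappa> \<tau> \<and> (\<exists>T>0. \<forall>t. \<gamma> (t + T) = \<gamma> t)"

definition hamiltonian :: "real \<Rightarrow> real \<Rightarrow> complex^3^3" where
  "hamiltonian \<kappa> \<tau> = (\<chi> r c. \<i> * (vector
     [vector [\<i> * of_real \<kappa>, - \<i>, of_real \<tau>],
      vector [0, - 2 * \<i> * of_real \<kappa>, 1],
      vector [1, 0, \<i> * of_real \<kappa>]] :: complex^3^3) $ r $ c)"

text \<open>Sign convention \<open>det (A - t I)\<close>, so that the leading coefficient is \<open>(-1)^n\<close>.\<close>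
definition charpoly :: "complex^'n^'n \<Rightarrow> complex poly" where
  "charpoly A = det (\<chi> i j. [:A $ i $ j:] - (if i = j then [:0, 1:] else 0))"

text \<open>The usual \<open>a^(2n-2) * (\<Prod>i<j. (r\<^sub>i - r\<^sub>j)^2)\<close>, where \<open>a\<close> is the leading coefficient and
  \<open>r\<^sub>1, \<dots>, r\<^sub>n\<close> are the roots with multiplicity. The product below runs over ordered pairs of
  distinct indices, which accounts for the sign.\<close>
definition discriminant :: "complex poly \<Rightarrow> complex" where
  "discriminant p =
     (- 1) ^ (degree p choose 2) * lead_coeff p ^ (2 * degree p - 2) *
     (\<Prod>x\<in>#proots p. \<Prod>y\<in>#proots p - {#x#}. x - y)"

end

theory Submission
  imports Defs "HOL-Computational_Algebra.Fundamental_Theorem_Algebra"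
begin

text \<open>The natural lift of an isoparametric curve solves the constant-coefficient equation
  \<open>\<Gamma>''' = \<i> Q \<Gamma> - P \<Gamma>'\<close> with \<open>P = 3\<kappa>\<^sup>2 - \<tau>\<close> and \<open>Q = 2\<kappa>\<^sup>3 + 2\<kappa>\<tau> - 1\<close>, whose characteristic exponents are
  \<open>- \<i> x\<close> for the eigenvalues \<open>x\<close> of the Hamiltonian. If the projective curve closes up, the factor
  between \<open>\<Gamma> (t + T)\<close> and \<open>\<Gamma> t\<close> has modulus 1, so \<open>\<Gamma>\<close> is bounded. Its components span the
  solution space, hence all solutions are bounded. A nonreal eigenvalue would give an unbounded
  exponential, and a multiple one an unbounded solution \<open>t exp (- \<i> x t)\<close>. So the three eigenvalues
  are real and distinct, and the discriminant is the square of the product of their differences.\<close>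

section \<open>The characteristic polynomial and its discriminant\<close>

lemma charpoly_hamiltonian:
  "charpoly (hamiltonian \<kappa> \<tau>) =
     [:of_real (2 * \<kappa> ^ 3 + 2 * \<kappa> * \<tau> - 1), of_real (3 * \<kappa>\<^sup>2 - \<tau>), 0, - 1:]"
  by (simp add: charpoly_def hamiltonian_def det_3 algebra_simps power2_eq_square power3_eq_cube
      complex_eq_iff)

lemma proots_cubic:
  fixes p :: "complex poly"
  assumes "degree p = 3"
  obtains x y z where "proots p = {#x, y, z#}"
    and "p = smult (lead_coeff p) ([:- x, 1:] * [:- y, 1:] * [:- z, 1:])"
proof -
  have "size (proots p) = Suc (Suc (Suc 0))"
    using assms by (simp add: size_proots_complex)
  then obtain x M where "proots p = add_mset x M" "size M = Suc (Suc 0)"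
    by (metis size_eq_Suc_imp_eq_union size_add_mset nat.inject)
  moreover from this(2) obtain y N where "M = add_mset y N" "size N = Suc 0"
    by (metis size_eq_Suc_imp_eq_union size_add_mset nat.inject)
  moreover from this(2) obtain z where "N = {#z#}"
    by (metis size_1_singleton_mset One_nat_def)
  ultimately have xyz: "proots p = {#x, y, z#}" by simp
  moreover have "p = smult (lead_coeff p) ([:- x, 1:] * [:- y, 1:] * [:- z, 1:])"
    using complex_poly_decompose_multiset[of p, symmetric] unfolding xyz
    by (simp add: algebra_simps)
  ultimately show thesis using that by blast
qed

text \<open>The six ordered differences pair up as \<open>(x - y) * (y - x) = - (x - y)^2\<close>.
  The resulting factor \<open>(-1)^3\<close> cancels the sign prefix, and the leading coefficient
  enters to the fourth power.\<close>

lemma discriminant_cubic: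
  assumes "degree p = 3" "lead_coeff p = - 1" "proots p = {#x, y, z#}"
  shows "discriminant p = ((x - y) * (y - z) * (z - x))\<^sup>2"
proof -
  \<comment> \<open>A single occurrence is removed, so both equations hold for coinciding roots
    too.\<close>
  have y: "{#x, y, z#} - {#y#} = {#x, z#}" and z: "{#x, y, z#} - {#z#} = {#x, y#}"
    by (simp_all add: add_mset_commute)
  have "(3::nat) choose 2 = 3"
    by (simp add: numeral_eq_Suc)
  then show ?thesis
    using assms by (simp add: discriminant_def y z power2_eq_square algebra_simps)
qed

section \<open>Linear equations of third order\<close>

lemma has_vector_derivative_mult_const:
  fixes f :: "real \<Rightarrow> complex"
  assumes "(f has_vector_derivative f') F"
  shows "((\<lambda>t. c * f t) has_vector_derivative c * f') F"
  using bounded_linear.has_vector_derivative[OF bounded_linear_mult_right assms] .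

lemma has_vector_derivative_exp:
  fixes a :: complex
  shows "((\<lambda>t. exp (a * of_real t)) has_vector_derivative a * exp (a * of_real t)) (at t)"
proof -
  have "((\<lambda>z. exp (a * z)) has_field_derivative a * exp (a * of_real t)) (at (of_real t))"
    by (auto intro!: derivative_eq_intros)
  from has_vector_derivative_real_field[OF this] show ?thesis by simp
qed

text \<open>The integrating factor \<open>exp (- c t)\<close> makes its product with
  \<open>y\<close> constant, and the value at 0 is 0.\<close>

lemma first_order_unique:
  fixes y :: "real \<Rightarrow> complex"
  assumes y: "\<And>t. (y has_vector_derivative c * y t) (at t)" and 0: "y 0 = 0"
  shows "y t = 0"
proof -
  have "((\<lambda>t. exp (- c * of_real t) * y t) has_vector_derivative 0) (at t within UNIV)" for t
    using has_vector_derivative_mult[OF has_vector_derivative_exp[of "- c" t] y[of t]]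
    by (simp add: algebra_simps)
  then obtain k where k: "\<And>t. exp (- c * of_real t) * y t = k"
    using has_vector_derivative_zero_constant[of UNIV "\<lambda>t. exp (- c * of_real t) * y t"]
    by auto
  from k[of 0] 0 have "k = 0" by simp
  with k[of t] show ?thesis by simp
qed

text \<open>The operator factors as (D - a)(D - b)(D - c), so first-order uniqueness peels off one
  factor at a time. The factorization also covers repeated exponents.\<close>

lemma third_order_unique:
  fixes f0 :: "real \<Rightarrow> complex"
  assumes f0: "\<And>t. (f0 has_vector_derivative f1 t) (at t)"
    and f1: "\<And>t. (f1 has_vector_derivative f2 t) (at t)"
    and f2: "\<And>t. (f2 has_vector_derivative
          (a + b + c) * f2 t - (a * b + b * c + c * a) * f1 t + a * b * c * f0 t) (at t)"
    and init: "f0 0 = 0" "f1 0 = 0" "f2 0 = 0"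
  shows "f0 t = 0"
proof -
  have u: "f2 t - (b + c) * f1 t + b * c * f0 t = 0" for t
  proof (rule first_order_unique[of "\<lambda>t. f2 t - (b + c) * f1 t + b * c * f0 t" a])
    fix t
    have "((\<lambda>t. f2 t - (b + c) * f1 t + b * c * f0 t) has_vector_derivative
        ((a + b + c) * f2 t - (a * b + b * c + c * a) * f1 t + a * b * c * f0 t)
          - (b + c) * f2 t + b * c * f1 t) (at t)"
      by (intro has_vector_derivative_add has_vector_derivative_diff has_vector_derivative_mult_const f0 f1 f2)
    then show "((\<lambda>t. f2 t - (b + c) * f1 t + b * c * f0 t) has_vector_derivative
        a * (f2 t - (b + c) * f1 t + b * c * f0 t)) (at t)"
      by (simp add: algebra_simps)
  qed (simp add: init)
  have v: "f1 t - c * f0 t = 0" for t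
  proof (rule first_order_unique[of "\<lambda>t. f1 t - c * f0 t" b])
    fix t
    have "((\<lambda>t. f1 t - c * f0 t) has_vector_derivative f2 t - c * f1 t) (at t)"
      by (intro has_vector_derivative_diff has_vector_derivative_mult_const f0 f1)
    moreover have "f2 t - c * f1 t = b * (f1 t - c * f0 t)"
      using u[of t] by (simp add: algebra_simps)
    ultimately show "((\<lambda>t. f1 t - c * f0 t) has_vector_derivative b * (f1 t - c * f0 t)) (at t)"
      by simp
  qed (simp add: init)
  show ?thesis
  proof (rule first_order_unique[of f0 c])
    fix t
    show "(f0 has_vector_derivative c * f0 t) (at t)"
      using f0[of t] v[of t] by simp
  qed (simp add: init)
qed

text \<open>Bilinear, without conjugation: a fixed \<open>x\<close> acts as a linear functional, and
  its values on the rows of a matrix are the entries of the product with \<open>*v\<close>.\<close>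

definition dot :: "complex^3 \<Rightarrow> complex^3 \<Rightarrow> complex" where
  "dot x v = x $ 1 * v $ 1 + x $ 2 * v $ 2 + x $ 3 * v $ 3"

lemma dot_linear:
  "dot x (v + w) = dot x v + dot x w" "dot x (v - w) = dot x v - dot x w"
  "dot x (c *s v) = c * dot x v"
  by (simp_all add: dot_def algebra_simps)

lemma has_vector_derivative_nth:
  fixes f :: "real \<Rightarrow> complex^3"
  assumes "(f has_vector_derivative f') F"
  shows "((\<lambda>t. f t $ k) has_vector_derivative f' $ k) F"
  using bounded_linear.has_vector_derivative[OF bounded_linear_vec_nth assms] .

lemma has_vector_derivative_dot:
  assumes "(f has_vector_derivative f') F"
  shows "((\<lambda>t. dot x (f t)) has_vector_derivative dot x f') F"
  unfolding dot_def
  by (intro has_vector_derivative_add has_vector_derivative_mult_const has_vector_derivative_nth assms)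

lemma norm_dot_le: "norm (dot x v) \<le> (norm (x $ 1) + norm (x $ 2) + norm (x $ 3)) * norm v"
proof -
  have "norm (dot x v) \<le> norm (x $ 1) * norm (v $ 1) + norm (x $ 2) * norm (v $ 2)
      + norm (x $ 3) * norm (v $ 3)"
    unfolding dot_def by (metis (no_types, lifting) norm_mult norm_triangle_mono order_refl)
  also have "\<dots> \<le> norm (x $ 1) * norm v + norm (x $ 2) * norm v + norm (x $ 3) * norm v"
    by (intro add_mono mult_left_mono norm_nth_le norm_ge_zero Finite_Cartesian_Product.norm_nth_le)
  finally show ?thesis by (simp add: algebra_simps)
qed

lemma exists_dot_prescribed:
  assumes "det (vector [u, v, w] :: complex^3^3) \<noteq> 0"
  obtains x where "dot x u = p" "dot x v = q" "dot x w = r"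
proof -
  let ?A = "vector [u, v, w] :: complex^3^3"
  obtain B where B: "?A ** B = mat 1"
    using assms invertible_det_nz[of ?A] unfolding invertible_def by blast
  define x where "x = B *v vector [p, q, r]"
  have x: "?A *v x = vector [p, q, r]"
    by (simp add: x_def matrix_vector_mul_assoc B)
  show thesis
  proof
    show "dot x u = p" "dot x v = q" "dot x w = r"
      using arg_cong[OF x, of "\<lambda>y. y $ 1"] arg_cong[OF x, of "\<lambda>y. y $ 2"]
        arg_cong[OF x, of "\<lambda>y. y $ 3"]
      by (simp_all add: matrix_vector_mult_def sum_3 dot_def algebra_simps)
  qed
qed

text \<open>The frame is a basis at 0, so some functional \<open>dot x\<close> carries its initial
  data to those of \<open>f0\<close>. By uniqueness \<open>f0\<close> is \<open>dot x\<close> of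
  \<open>e0\<close> at all times, hence bounded by a multiple of its norm.\<close>

lemma solutions_bounded:
  fixes e0 :: "real \<Rightarrow> complex^3" and f0 :: "real \<Rightarrow> complex"
  assumes e0: "\<And>t. (e0 has_vector_derivative e1 t) (at t)"
    and e1: "\<And>t. (e1 has_vector_derivative e2 t) (at t)"
    and e2: "\<And>t. (e2 has_vector_derivative
          (a + b + c) *s e2 t - (a * b + b * c + c * a) *s e1 t + (a * b * c) *s e0 t) (at t)"
    and det: "det (vector [e0 0, e1 0, e2 0] :: complex^3^3) \<noteq> 0"
    and bdd: "bounded (range e0)"
    and f0: "\<And>t. (f0 has_vector_derivative f1 t) (at t)"
    and f1: "\<And>t. (f1 has_vector_derivative f2 t) (at t)"
    and f2: "\<And>t. (f2 has_vector_derivative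
          (a + b + c) * f2 t - (a * b + b * c + c * a) * f1 t + a * b * c * f0 t) (at t)"
  shows "bounded (range f0)"
proof -
  obtain x where x: "dot x (e0 0) = f0 0" "dot x (e1 0) = f1 0" "dot x (e2 0) = f2 0"
    using exists_dot_prescribed[OF det] by blast
  have eq: "dot x (e0 t) - f0 t = 0" for t
  proof (rule third_order_unique[of "\<lambda>t. dot x (e0 t) - f0 t" "\<lambda>t. dot x (e1 t) - f1 t"
        "\<lambda>t. dot x (e2 t) - f2 t" a b c])
    fix t
    have "((\<lambda>t. dot x (e2 t) - f2 t) has_vector_derivative
        dot x ((a + b + c) *s e2 t - (a * b + b * c + c * a) *s e1 t + (a * b * c) *s e0 t)
        - ((a + b + c) * f2 t - (a * b + b * c + c * a) * f1 t + a * b * c * f0 t)) (at t)"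
      by (intro has_vector_derivative_diff has_vector_derivative_dot e2 f2)
    then show "((\<lambda>t. dot x (e2 t) - f2 t) has_vector_derivative
        (a + b + c) * (dot x (e2 t) - f2 t) - (a * b + b * c + c * a) * (dot x (e1 t) - f1 t)
        + a * b * c * (dot x (e0 t) - f0 t)) (at t)"
      by (simp add: dot_linear algebra_simps)
  qed (auto intro!: has_vector_derivative_diff has_vector_derivative_dot e0 e1 f0 f1 simp: x)
  from bdd obtain K where K: "\<And>t. norm (e0 t) \<le> K"
    by (auto simp: bounded_iff)
  have "norm (f0 t) \<le> (norm (x $ 1) + norm (x $ 2) + norm (x $ 3)) * K" for t
  proof -
    have "norm (f0 t) = norm (dot x (e0 t))" using eq[of t] by simp
    also have "\<dots> \<le> (norm (x $ 1) + norm (x $ 2) + norm (x $ 3)) * norm (e0 t)"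
      by (rule norm_dot_le)
    also have "\<dots> \<le> (norm (x $ 1) + norm (x $ 2) + norm (x $ 3)) * K"
      by (intro mult_left_mono K) simp
    finally show ?thesis .
  qed
  then show ?thesis by (auto simp: bounded_iff)
qed

lemma bounded_exp_imp_imaginary:
  assumes "bounded (range (\<lambda>t. exp (a * complex_of_real t)))"
  shows "Re a = 0"
proof (rule ccontr)
  assume a: "Re a \<noteq> 0"
  from assms obtain K where K: "\<And>t. norm (exp (a * complex_of_real t)) \<le> K"
    by (auto simp: bounded_iff)
  have "1 + K \<le> exp K" by (rule exp_ge_add_one_self)
  \<comment> \<open>At time \<open>K / Re a\<close> the modulus of the exponential is exactly
    \<open>exp K\<close>.\<close>
  also have "\<dots> \<le> K" using K[of "K / Re a"] a by simp
  finally show False by simp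
qed

lemma not_bounded_linear_exp:
  assumes "Re a = 0"
  shows "\<not> bounded (range (\<lambda>t. complex_of_real t * exp (a * complex_of_real t)))"
proof
  assume "bounded (range (\<lambda>t. complex_of_real t * exp (a * complex_of_real t)))"
  then obtain K where K: "\<And>t. norm (complex_of_real t * exp (a * complex_of_real t)) \<le> K"
    by (auto simp: bounded_iff)
  have "\<bar>t\<bar> \<le> K" for t
    using K[of t] assms by (simp add: norm_mult)
  from this[of "1 + \<bar>K\<bar>"] show False by simp
qed

text \<open>The root \<open>a\<close> gives the solution \<open>exp (a t)\<close>, and a double root
  would also give \<open>t exp (a t)\<close>. The coefficients are symmetric in the roots, so the
  other roots and pairs follow by permutation.\<close>

lemma bounded_frame_roots:
  fixes e0 :: "real \<Rightarrow> complex^3"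
  assumes e0: "\<And>t. (e0 has_vector_derivative e1 t) (at t)"
    and e1: "\<And>t. (e1 has_vector_derivative e2 t) (at t)"
    and e2: "\<And>t. (e2 has_vector_derivative
          (a + b + c) *s e2 t - (a * b + b * c + c * a) *s e1 t + (a * b * c) *s e0 t) (at t)"
    and det: "det (vector [e0 0, e1 0, e2 0] :: complex^3^3) \<noteq> 0"
    and bdd: "bounded (range e0)"
  shows "Re a = 0" "a \<noteq> b"
proof -
  let ?E = "\<lambda>t. exp (a * complex_of_real t)"
  have "bounded (range ?E)"
  proof (rule solutions_bounded[OF e0 e1 e2 det bdd, where ?f0.0 = ?E and ?f1.0 = "\<lambda>t. a * ?E t"
        and ?f2.0 = "\<lambda>t. a * (a * ?E t)"])
    fix t
    have "((\<lambda>t. a * (a * ?E t)) has_vector_derivative a * (a * (a * ?E t))) (at t)"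
      by (intro has_vector_derivative_mult_const has_vector_derivative_exp)
    then show "((\<lambda>t. a * (a * ?E t)) has_vector_derivative (a + b + c) * (a * (a * ?E t))
        - (a * b + b * c + c * a) * (a * ?E t) + a * b * c * ?E t) (at t)"
      by (simp add: algebra_simps)
  qed (intro has_vector_derivative_mult_const has_vector_derivative_exp)+
  then show Re: "Re a = 0" by (rule bounded_exp_imp_imaginary)
  show "a \<noteq> b"
  proof
    assume ab: "a = b"
    let ?F = "\<lambda>t. complex_of_real t * ?E t"
    have F: "(?F has_vector_derivative ?E t + a * ?F t) (at t)" for t
      using has_vector_derivative_mult[OF has_vector_derivative_of_real[OF DERIV_ident] has_vector_derivative_exp[of a t]]
      by (simp add: algebra_simps)
    have F1: "((\<lambda>t. ?E t + a * ?F t) has_vector_derivative a * ?E t + a * (?E t + a * ?F t)) (at t)"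
      for t
      by (intro has_vector_derivative_add has_vector_derivative_mult_const has_vector_derivative_exp F)
    have "bounded (range ?F)"
    proof (rule solutions_bounded[OF e0 e1 e2 det bdd F F1])
      fix t
      have "((\<lambda>t. a * ?E t + a * (?E t + a * ?F t)) has_vector_derivative
          a * (a * ?E t) + a * (a * ?E t + a * (?E t + a * ?F t))) (at t)"
        by (intro has_vector_derivative_add has_vector_derivative_mult_const has_vector_derivative_exp F)
      then show "((\<lambda>t. a * ?E t + a * (?E t + a * ?F t)) has_vector_derivative
          (a + b + c) * (a * ?E t + a * (?E t + a * ?F t))
          - (a * b + b * c + c * a) * (?E t + a * ?F t) + a * b * c * ?F t) (at t)"
        \<comment> \<open>With \<open>b = a\<close> the characteristic polynomial and its derivative
          both vanish at \<open>a\<close>, which cancels the terms with and without the factor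
          \<open>t\<close>.\<close>
        unfolding ab[symmetric] by (simp add: algebra_simps)
    qed
    with not_bounded_linear_exp[OF Re] show False by simp
  qed
qed

section \<open>The Hermitian form and the moving frame\<close>

lemma herm_expand:
  "herm z w = \<i> * (cnj (z $ 1) * w $ 3 - cnj (z $ 3) * w $ 1) + cnj (z $ 2) * w $ 2"
  by (simp add: herm_def herm_matrix_def sum_3 algebra_simps)

lemma herm_linear:
  "herm z (v + w) = herm z v + herm z w"
  "herm z (c *s v) = c * herm z v" "herm (c *s z) v = cnj c * herm z v"
  by (simp_all add: herm_expand algebra_simps)

lemma herm_cnj: "cnj (herm z w) = herm w z"
  by (simp add: herm_expand algebra_simps)

lemma has_vector_derivative_herm:
  fixes f g :: "real \<Rightarrow> complex^3"
  assumes "(f has_vector_derivative f') (at t)" "(g has_vector_derivative g') (at t)"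
  shows "((\<lambda>t. herm (f t) (g t)) has_vector_derivative herm (f t) g' + herm f' (g t)) (at t)"
proof -
  note f = has_vector_derivative_cnj[OF has_vector_derivative_nth[OF assms(1)]] and g = has_vector_derivative_nth[OF assms(2)]
  show ?thesis
    unfolding herm_expand
    by (rule has_vector_derivative_eq_rhs, (rule has_vector_derivative_add
          has_vector_derivative_diff has_vector_derivative_mult_const has_vector_derivative_mult f g)+)
      (simp add: algebra_simps)
qed

lemma has_vector_derivative_det:
  fixes f g h :: "real \<Rightarrow> complex^3"
  assumes "(f has_vector_derivative f') (at t)" "(g has_vector_derivative g') (at t)"
    "(h has_vector_derivative h') (at t)"
  shows "((\<lambda>t. det (vector [f t, g t, h t] :: complex^3^3)) has_vector_derivative
    det (vector [f', g t, h t] :: complex^3^3) + det (vector [f t, g', h t] :: complex^3^3)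
     + det (vector [f t, g t, h'] :: complex^3^3)) (at t)"
proof -
  note f = has_vector_derivative_nth[OF assms(1)] and g = has_vector_derivative_nth[OF assms(2)] and h = has_vector_derivative_nth[OF assms(3)]
  show ?thesis
    unfolding det_3 vector_3
    by (rule has_vector_derivative_eq_rhs, (rule has_vector_derivative_add
          has_vector_derivative_diff has_vector_derivative_mult f g h)+)
      (simp add: algebra_simps)
qed

text \<open>With the vectors as rows of V, the Gram matrix is the product of the conjugate of V,
  \<open>herm_matrix\<close> and the transpose of V; the determinant of \<open>herm_matrix\<close>
  is -1.\<close>

lemma det_gram:
  "det (vector [vector [herm u u, herm u v, herm u w], vector [herm v u, herm v v, herm v w],
      vector [herm w u, herm w v, herm w w]] :: complex^3^3)
   = - (cnj (det (vector [u, v, w] :: complex^3^3)) * det (vector [u, v, w] :: complex^3^3))"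
  unfolding det_3 vector_3 herm_expand
  by (simp add: algebra_simps)

text \<open>Differentiating the constant products, together with the Gram determinant, fixes all
  products of the frame. The derivatives of the frame determinant and of two products then fix the
  three coordinates of \<open>e3\<close>.\<close>

lemma frenet_equation:
  fixes e0 :: "real \<Rightarrow> complex^3"
  assumes e0: "\<And>t. (e0 has_vector_derivative e1 t) (at t)"
    and e1: "\<And>t. (e1 has_vector_derivative e2 t) (at t)"
    and e2: "\<And>t. (e2 has_vector_derivative e3 t) (at t)"
    and det: "\<And>t. det (vector [e0 t, e1 t, e2 t] :: complex^3^3) = - 1"
    and h00: "\<And>t. herm (e0 t) (e0 t) = 0"
    and h01: "\<And>t. herm (e0 t) (e1 t) = \<i>"
    and h11: "\<And>t. herm (e1 t) (e1 t) = of_real (2 * \<kappa>)"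
    and h21: "\<And>t. Im (herm (e2 t) (e1 t)) = \<tau> - 3 * \<kappa>\<^sup>2"
  shows "e3 t = (\<i> * of_real (2 * \<kappa> ^ 3 + 2 * \<kappa> * \<tau> - 1)) *s e0 t
           + of_real (\<tau> - 3 * \<kappa>\<^sup>2) *s e1 t"
proof -
  have const: "f' = 0" if "(f has_vector_derivative f') (at s)" "\<And>s. f s = c"
    for f :: "real \<Rightarrow> complex" and f' s c
  proof -
    have "f = (\<lambda>_. c)" using that(2) by auto
    then show ?thesis
      using vector_derivative_unique_at[OF that(1)] has_vector_derivative_const by metis
  qed
  define b where "b = \<tau> - 3 * \<kappa>\<^sup>2"
  have h02: "herm (e0 s) (e2 s) = of_real (- 2 * \<kappa>)" for s
    using const[OF has_vector_derivative_herm[OF e0 e1] h01, of s] h11[of s] by (simp add: add_eq_0_iff)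
  \<comment> \<open>Constancy of \<open>herm (e1 s) (e1 s)\<close> leaves only an imaginary part,
    which the twist prescribes.\<close>
  have h12: "herm (e1 s) (e2 s) = - \<i> * of_real b" and h21': "herm (e2 s) (e1 s) = \<i> * of_real b"
    for s
  proof -
    have *: "herm (e1 s) (e2 s) + herm (e2 s) (e1 s) = 0"
      using const[OF has_vector_derivative_herm[OF e1 e1] h11, of s] .
    have "herm (e1 s) (e2 s) = cnj (herm (e2 s) (e1 s))" by (simp add: herm_cnj)
    with * have "Re (herm (e2 s) (e1 s)) = 0" by (simp add: complex_eq_iff)
    with h21[of s] show "herm (e2 s) (e1 s) = \<i> * of_real b"
      by (simp add: complex_eq_iff b_def)
    with * show "herm (e1 s) (e2 s) = - \<i> * of_real b" by (simp add: add_eq_0_iff)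
  qed
  have h03: "herm (e0 t) (e3 t) = \<i> * of_real b"
    using const[OF has_vector_derivative_herm[OF e0 e2] h02, of t] h12[of t] by (simp add: add_eq_0_iff)
  have h10: "herm (e1 t) (e0 t) = - \<i>" and h20: "herm (e2 t) (e0 t) = of_real (- 2 * \<kappa>)"
    using herm_cnj[of "e0 t"] h01[of t] h02[of t] by (metis complex_cnj_i complex_cnj_complex_of_real)+
  \<comment> \<open>The Gram identity is linear in this last unknown entry, with coefficient
    -1.\<close>
  have h22: "herm (e2 t) (e2 t) = of_real (1 - 4 * \<kappa> * b - 8 * \<kappa> ^ 3)"
    using det_gram[of "e0 t" "e1 t" "e2 t"]
    unfolding h00 h01 h11 h02 h12 h21' h10 h20 det
    by (simp add: det_3 algebra_simps power3_eq_cube)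
  have h13: "herm (e1 t) (e3 t) = - herm (e2 t) (e2 t)"
    using const[OF has_vector_derivative_herm[OF e1 e2] h12, of t] by (simp add: add_eq_0_iff2)
  \<comment> \<open>Two of the three terms in the derivative of the determinant have a repeated
    row.\<close>
  have det3: "det (vector [e0 t, e1 t, e3 t] :: complex^3^3) = 0"
    using const[OF has_vector_derivative_det[OF e0 e1 e2] det, of t] by (simp add: det_3 algebra_simps)
  \<comment> \<open>The frame vectors become columns, so a preimage of \<open>e3 t\<close> consists
    of its coordinates in the frame.\<close>
  let ?A = "transpose (vector [e0 t, e1 t, e2 t]) :: complex^3^3"
  obtain B where "?A ** B = mat 1"
    using det[of t] invertible_det_nz[of ?A] unfolding invertible_def
    by (auto simp: det_transpose)
  then have "?A *v (B *v e3 t) = e3 t" by (simp add: matrix_vector_mul_assoc)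
  then obtain x where x: "?A *v x = e3 t" by blast
  define p q r where "p = x $ 1" and "q = x $ 2" and "r = x $ 3"
  have e3: "e3 t = p *s e0 t + q *s e1 t + r *s e2 t"
    unfolding x[symmetric] p_def q_def r_def
    by (simp add: vec_eq_iff matrix_vector_mult_def transpose_def sum_3 forall_3 algebra_simps)
  have "det (vector [e0 t, e1 t, e3 t] :: complex^3^3)
      = r * det (vector [e0 t, e1 t, e2 t] :: complex^3^3)"
    unfolding e3 by (simp add: det_3 algebra_simps)
  then have r: "r = 0" using det3 det[of t] by simp
  \<comment> \<open>Pairing with the null vector \<open>e0 t\<close> isolates \<open>q\<close>;
    pairing with \<open>e1 t\<close> then gives \<open>p\<close>.\<close>
  have q: "q = of_real b"
    using h03 h00[of t] h01[of t] unfolding e3 r by (simp add: herm_linear)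
  have "- \<i> * p + 2 * \<kappa> * q = - of_real (1 - 4 * \<kappa> * b - 8 * \<kappa> ^ 3)"
    using h13 h22 h10 h11[of t] unfolding e3 r by (simp add: herm_linear mult.commute)
  then have "p = - \<i> * of_real (1 - 2 * \<kappa> * b - 8 * \<kappa> ^ 3)"
    unfolding q by (simp add: complex_eq_iff algebra_simps)
  also have "\<dots> = \<i> * of_real (2 * \<kappa> ^ 3 + 2 * \<kappa> * \<tau> - 1)"
    by (simp add: b_def complex_eq_iff algebra_simps power2_eq_square power3_eq_cube)
  finally show ?thesis using e3 r q by (simp add: b_def)
qed

section \<open>Lifts of closed curves\<close>

lemma norm_vector_scalar_mult:
  fixes v :: "complex^3"
  shows "norm (c *s v) = norm c * norm v"
  by (simp add: norm_vec_def L2_set_def norm_mult power_mult_distrib sum_distrib_left[symmetric]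
      real_sqrt_mult)

text \<open>The normalization of \<open>\<langle>\<Gamma>, \<Gamma>'\<rangle>\<close> forces the factor between \<open>\<Gamma> (t + T)\<close> and \<open>\<Gamma> t\<close> to be unimodular.\<close>

lemma norm_lift_periodic:
  fixes e0 :: "real \<Rightarrow> complex^3"
  assumes e0: "\<And>t. (e0 has_vector_derivative e1 t) (at t)"
    and h00: "\<And>t. herm (e0 t) (e0 t) = 0"
    and h01: "\<And>t. herm (e0 t) (e1 t) = \<i>"
    and nz: "\<And>t. e0 t \<noteq> 0"
    and per: "\<And>t. \<exists>c. e0 (t + T) = c *s e0 t"
  shows "norm (e0 (t + T)) = norm (e0 t)"
proof -
  \<comment> \<open>The modulus of the scale factor, written as a quotient of norms so that it is
    visibly continuous whatever scalars \<open>per\<close> provides.\<close>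
  define q where "q s = norm (e0 (s + T)) / norm (e0 s)" for s
  have q: "norm (herm (e0 (t + T)) (e0 (s + T))) = q t * q s * norm (herm (e0 t) (e0 s))" for s
  proof -
    obtain c d where cd: "e0 (t + T) = c *s e0 t" "e0 (s + T) = d *s e0 s" using per by metis
    moreover have "q t = norm c" "q s = norm d"
      using nz by (simp_all add: q_def cd norm_vector_scalar_mult)
    ultimately show ?thesis by (simp add: herm_linear norm_mult)
  qed
  \<comment> \<open>As a function of \<open>s\<close>, \<open>herm (e0 u) (e0 s)\<close> vanishes at
    \<open>u\<close> with derivative \<i>, so the modulus of its difference quotient tends to
    1.\<close>
  have lim: "((\<lambda>s. norm (herm (e0 u) (e0 (s + u))) / \<bar>s\<bar>) \<longlongrightarrow> 1) (at 0)" for u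
  proof -
    have "((\<lambda>s. herm (e0 u) (e0 s)) has_vector_derivative \<i>) (at u)"
      using has_vector_derivative_herm[OF has_vector_derivative_const[of "e0 u"] e0[of u]] h01[of u]
      by (simp add: herm_expand)
    then have quotient: "((\<lambda>s. norm (herm (e0 u) (e0 (u + s)) - s *\<^sub>R \<i>) / norm s) \<longlongrightarrow> 0) (at 0)"
      by (simp add: has_vector_derivative_def has_derivative_at h00)
    have "norm (herm (e0 u) (e0 (u + s)) - s *\<^sub>R \<i>) / norm s
        = norm ((1 / s) *\<^sub>R herm (e0 u) (e0 (u + s)) - \<i>)" if "s \<noteq> 0" for s
    proof -
      have "(1 / s) *\<^sub>R herm (e0 u) (e0 (u + s)) - \<i>
          = (1 / s) *\<^sub>R (herm (e0 u) (e0 (u + s)) - s *\<^sub>R \<i>)"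
        using that by (simp add: scaleR_diff_right)
      then show ?thesis by simp
    qed
    then have "\<forall>\<^sub>F s in at 0. norm (herm (e0 u) (e0 (u + s)) - s *\<^sub>R \<i>) / norm s
        = norm ((1 / s) *\<^sub>R herm (e0 u) (e0 (u + s)) - \<i>)"
      unfolding eventually_at_filter by (intro always_eventually allI impI)
    with quotient have "((\<lambda>s. norm ((1 / s) *\<^sub>R herm (e0 u) (e0 (u + s)) - \<i>)) \<longlongrightarrow> 0) (at 0)"
      by (rule Lim_transform_eventually)
    then have "((\<lambda>s. (1 / s) *\<^sub>R herm (e0 u) (e0 (u + s))) \<longlongrightarrow> \<i>) (at 0)"
      by (rule LIM_zero_cancel[OF tendsto_norm_zero_cancel])
    from tendsto_norm[OF this] show ?thesis
      by (simp add: h00 add.commute)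
  qed
  have "isCont e0 s" for s
    using e0 has_vector_derivative_continuous by blast
  then have "isCont (\<lambda>s. norm (e0 (s + u))) 0" for u
    by (intro isCont_norm isCont_o2[where f = "\<lambda>s. s + u" and g = e0]) simp_all
  from isCont_divide[OF this[of "t + T"] this[of t]] have "isCont (\<lambda>s. q (s + t)) 0"
    using nz by (simp add: q_def add.assoc)
  then have "((\<lambda>s. q (s + t)) \<longlongrightarrow> q t) (at 0)"
    by (simp add: isCont_def)
  \<comment> \<open>The quotients based at \<open>t + T\<close> have two limits: the square of
    \<open>q t\<close> through the scaling, and 1 directly.\<close>
  then have "((\<lambda>s. q t * q (s + t) * (norm (herm (e0 t) (e0 (s + t))) / \<bar>s\<bar>))
      \<longlongrightarrow> q t * q t * 1) (at 0)"
    by (intro tendsto_intros lim)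
  moreover have "(\<lambda>s. q t * q (s + t) * (norm (herm (e0 t) (e0 (s + t))) / \<bar>s\<bar>))
      = (\<lambda>s. norm (herm (e0 (t + T)) (e0 (s + (t + T)))) / \<bar>s\<bar>)"
    using q by (simp add: fun_eq_iff flip: add.assoc)
  ultimately have "((\<lambda>s. norm (herm (e0 (t + T)) (e0 (s + (t + T)))) / \<bar>s\<bar>)
      \<longlongrightarrow> q t * q t * 1) (at 0)"
    by (simp only:)
  from tendsto_unique[OF trivial_limit_at this lim] have "q t * q t * 1 = 1" .
  moreover have "q t \<ge> 0" by (simp add: q_def)
  ultimately have "q t = 1" by (simp add: abs_square_eq_1 flip: power2_eq_square)
  then show ?thesis using nz by (simp add: q_def divide_eq_1_iff)
qed

text \<open>Periodicity is asked of the norm alone, which suits a lift that returns only up to a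
  unimodular factor. Compactness of one period gives the bound.\<close>

lemma bounded_range_periodic_norm:
  fixes f :: "real \<Rightarrow> 'a::real_normed_vector"
  assumes cont: "continuous_on UNIV f" and T: "T > 0" and per: "\<And>t. norm (f (t + T)) = norm (f t)"
  shows "bounded (range f)"
proof -
  have "bounded (f ` {0..T})"
    using cont by (intro compact_imp_bounded compact_continuous_image) (auto intro: continuous_on_subset)
  then obtain K where K: "\<And>t. 0 \<le> t \<Longrightarrow> t \<le> T \<Longrightarrow> norm (f t) \<le> K"
    unfolding bounded_iff by (metis atLeastAtMost_iff imageI)
  have nat: "norm (f (t + of_nat n * T)) = norm (f t)" for t n
  proof (induction n)
    case (Suc n)
    with per[of "t + of_nat n * T"] show ?case by (simp add: algebra_simps)
  qed simp
  have int: "norm (f (t + of_int k * T)) = norm (f t)" for t k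
  proof (cases k)
    case (nonneg n)
    then show ?thesis using nat[of t n] by simp
  next
    case (neg n)
    \<comment> \<open>In this case \<open>k\<close> is \<open>- Suc n\<close>, so moving the shifted
      point forward by \<open>Suc n\<close> periods leads back to \<open>t\<close>.\<close>
    then have k: "of_int k = - (of_nat (Suc n) :: real)" by simp
    have "t + of_int k * T + of_nat (Suc n) * T = t" unfolding k by (simp del: of_nat_Suc)
    then show ?thesis using nat[of "t + of_int k * T" "Suc n"] by metis
  qed
  have "norm (f t) \<le> K" for t
  proof -
    have "of_int \<lfloor>t / T\<rfloor> * T \<le> t / T * T" "t / T * T \<le> (of_int \<lfloor>t / T\<rfloor> + 1) * T"
      using T by (intro mult_right_mono; linarith)+
    then have "0 \<le> t - of_int \<lfloor>t / T\<rfloor> * T" "t - of_int \<lfloor>t / T\<rfloor> * T \<le> T"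
      using T by (simp_all add: distrib_right)
    then have "norm (f (t - of_int \<lfloor>t / T\<rfloor> * T)) \<le> K" by (rule K)
    then show ?thesis using int[of "t - of_int \<lfloor>t / T\<rfloor> * T" "\<lfloor>t / T\<rfloor>"] by simp
  qed
  then show ?thesis by (auto simp: bounded_iff)
qed

lemma proj_class_eqD:
  assumes "proj_class v = proj_class w"
  shows "\<exists>c. v = c *s w"
proof -
  have "v \<in> proj_class v" by (auto simp: proj_class_def intro!: exI[of _ 1])
  then show ?thesis unfolding assms by (auto simp: proj_class_def)
qed

lemma curve_deriv_has_vector_derivative:
  assumes "smooth_curve_on UNIV \<Gamma>"
  shows "(curve_deriv n \<Gamma> has_vector_derivative curve_deriv (Suc n) \<Gamma> t) (at t)"
  using assms by (simp add: smooth_curve_on_def curve_deriv_def vector_derivative_works)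

section \<open>Real distinct eigenvalues for a closed curve\<close>

theorem proposition4p2:
  fixes \<gamma> :: "real \<Rightarrow> (complex^3) set" and \<kappa> \<tau> :: real
  assumes "isoparametric_string \<gamma> \<kappa> \<tau>"
  shows "\<exists>D :: real.
           discriminant (charpoly (hamiltonian \<kappa> \<tau>)) = complex_of_real D \<and>
           D = - 27 + 108 * \<kappa> * (\<kappa>^2 + \<tau>) - 324 * \<kappa>^4 * \<tau> - 72 * \<kappa>^2 * \<tau>^2 - 4 * \<tau>^3 \<and>
           D > 0"
proof -
  from assms obtain \<Gamma> T where nat: "natural_lift \<Gamma> \<gamma>"
    and bend: "\<And>t. bending \<Gamma> t = \<kappa>" and twist: "\<And>t. twist \<Gamma> t = \<tau>"
    and T: "T > 0" and per: "\<And>t. \<gamma> (t + T) = \<gamma> t"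
    unfolding isoparametric_string_def isoparametric_def by blast
  define e0 e1 e2 e3 where e: "e0 = \<Gamma>" "e1 = curve_deriv 1 \<Gamma>" "e2 = curve_deriv 2 \<Gamma>"
    "e3 = curve_deriv 3 \<Gamma>"
  from nat have smooth: "smooth_curve_on UNIV \<Gamma>"
    and null: "\<And>t. \<Gamma> t \<in> null_vectors" and lift: "\<And>t. \<gamma> t = proj_class (\<Gamma> t)"
    and wr: "\<And>t. wronskian \<Gamma> t = - 1"
    and nat1: "\<And>t. \<i> * inverse (herm (\<Gamma> t) (curve_deriv 1 \<Gamma> t)) = 1"
    by (auto simp: natural_lift_def wilczynski_lift_def is_lift_def)
  have d0: "(e0 has_vector_derivative e1 t) (at t)" and d1: "(e1 has_vector_derivative e2 t) (at t)"
    and d2: "(e2 has_vector_derivative e3 t) (at t)" for t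
    using curve_deriv_has_vector_derivative[OF smooth, of 0 t] curve_deriv_has_vector_derivative[OF smooth, of 1 t]
      curve_deriv_has_vector_derivative[OF smooth, of 2 t]
    by (simp_all add: e curve_deriv_def numeral_eq_Suc)
  have det: "det (vector [e0 t, e1 t, e2 t] :: complex^3^3) = - 1" for t
    using wr[of t] by (simp add: wronskian_def det_transpose e)
  have h00: "herm (e0 t) (e0 t) = 0" and nz: "e0 t \<noteq> 0" for t
    using null[of t] by (auto simp: null_vectors_def e)
  have h01: "herm (e0 t) (e1 t) = \<i>" for t
    using nat1[of t] unfolding e by (metis divide_inverse divide_eq_1_iff)
  have h11: "herm (e1 t) (e1 t) = of_real (2 * \<kappa>)" for t
  proof -
    have "cnj (herm (e1 t) (e1 t)) = herm (e1 t) (e1 t)" by (rule herm_cnj)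
    then have "Im (herm (e1 t) (e1 t)) = 0" by (simp add: complex_eq_iff)
    with bend[of t] show ?thesis by (simp add: bending_def complex_eq_iff e)
  qed
  have h21: "Im (herm (e2 t) (e1 t)) = \<tau> - 3 * \<kappa>\<^sup>2" for t
    using twist[of t] bend[of t] by (simp add: twist_def e)
  note frenet = frenet_equation[OF d0 d1 d2 det h00 h01 h11 h21]
  have bdd: "bounded (range e0)"
  proof (rule bounded_range_periodic_norm[OF _ T])
    show "continuous_on UNIV e0"
      using d0 has_vector_derivative_continuous continuous_at_imp_continuous_on by blast
    show "norm (e0 (t + T)) = norm (e0 t)" for t
    proof (rule norm_lift_periodic[OF d0 h00 h01 nz])
      show "\<exists>c. e0 (t + T) = c *s e0 t" for t
        using per[of t] unfolding lift e by (rule proj_class_eqD)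
    qed
  qed
  define P Q where "P = 3 * \<kappa>\<^sup>2 - \<tau>" and "Q = 2 * \<kappa> ^ 3 + 2 * \<kappa> * \<tau> - 1"
  let ?p = "charpoly (hamiltonian \<kappa> \<tau>)"
  have p: "?p = [:of_real Q, of_real P, 0, - 1:]"
    by (simp add: charpoly_hamiltonian P_def Q_def)
  have deg: "degree ?p = 3" and lc: "lead_coeff ?p = - 1" by (simp_all add: p)
  obtain x y z where xyz: "proots ?p = {#x, y, z#}"
    and fac: "?p = smult (- 1) ([:- x, 1:] * [:- y, 1:] * [:- z, 1:])"
    using proots_cubic[OF deg] unfolding lc by blast
  \<comment> \<open>Vieta's relations: the absent square term gives the zero sum, and the leading
    coefficient -1 fixes the sign of the product.\<close>
  have s1: "x + y + z = 0" and s3: "x * y * z = of_real Q"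
    using arg_cong[OF fac, of "\<lambda>p. coeff p 0"] arg_cong[OF fac, of "\<lambda>p. coeff p 2"]
    unfolding p by (simp_all add: coeff_pCons numeral_eq_Suc algebra_simps)
  have P: "of_real P = z * (- y - x) - y * x"
    using arg_cong[OF fac, of "\<lambda>p. coeff p 1"]
    unfolding p by (simp add: coeff_pCons numeral_eq_Suc)
  have s2: "x * y + y * z + z * x = - of_real P"
    unfolding P by (simp add: algebra_simps)
  \<comment> \<open>Stated for any triple with the same elementary symmetric functions, so that it
    can be applied to the cyclic permutations of the eigenvalues.\<close>
  have roots: "Im u = 0 \<and> u \<noteq> v"
    if s: "u + v + w = x + y + z" "u * v + v * w + w * u = x * y + y * z + z * x"
      "u * v * w = x * y * z" for u v w
  proof -
    \<comment> \<open>Multiplying the roots by -\<i> multiplies their symmetric functions by -\<i>,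
      -1 and \<i>, which yields the coefficients of the frame equation. Moreover
      \<open>Re (- \<i> * u) = Im u\<close>.\<close>
    let ?a = "- \<i> * u" and ?b = "- \<i> * v" and ?c = "- \<i> * w"
    have "?a + ?b + ?c = - \<i> * (u + v + w)" by (simp add: algebra_simps)
    then have sum: "?a + ?b + ?c = 0" using s(1) s1 by simp
    have "?a * ?b + ?b * ?c + ?c * ?a = - (u * v + v * w + w * u)"
      by (simp add: algebra_simps)
    then have sum2: "?a * ?b + ?b * ?c + ?c * ?a = of_real P" using s(2) s2 by simp
    have "?a * ?b * ?c = \<i> * (u * v * w)" by (simp add: algebra_simps)
    then have sum3: "?a * ?b * ?c = \<i> * of_real Q" using s(3) s3 by simp
    have "(e2 has_vector_derivative (?a + ?b + ?c) *s e2 t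
        - (?a * ?b + ?b * ?c + ?c * ?a) *s e1 t + (?a * ?b * ?c) *s e0 t) (at t)" for t
    proof -
      have "e3 t = (?a + ?b + ?c) *s e2 t
        - (?a * ?b + ?b * ?c + ?c * ?a) *s e1 t + (?a * ?b * ?c) *s e0 t"
        unfolding frenet sum sum2 sum3 P_def Q_def by (simp add: vec_eq_iff algebra_simps)
      with d2[of t] show ?thesis by simp
    qed
    from bounded_frame_roots[OF d0 d1 this _ bdd] det[of 0] show ?thesis by simp
  qed
  have x: "Im x = 0 \<and> x \<noteq> y" by (rule roots[of x y z]) simp_all
  have y: "Im y = 0 \<and> y \<noteq> z" by (rule roots[of y z x]) (simp_all add: algebra_simps)
  have z: "Im z = 0 \<and> z \<noteq> x" by (rule roots[of z x y]) (simp_all add: algebra_simps)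
  obtain X Y Z where XYZ: "x = of_real X" "y = of_real Y" "z = of_real Z"
    using x y z by (metis complex_is_Real_iff Reals_cases)
  define D where "D = ((X - Y) * (Y - Z) * (Z - X))\<^sup>2"
  have "discriminant ?p = of_real D"
    unfolding discriminant_cubic[OF deg lc xyz] by (simp add: D_def XYZ)
  moreover have "D > 0"
    using x y z unfolding XYZ by (simp add: D_def)
  \<comment> \<open>The classical discriminant of the depressed cubic with linear coefficient
    \<open>- P\<close> and constant term \<open>- Q\<close>. Eliminating \<open>Z\<close> by the
    zero sum leaves a polynomial identity in \<open>X\<close> and \<open>Y\<close>.\<close>
  moreover have "D = 4 * P ^ 3 - 27 * Q\<^sup>2"
  proof -
    have Z: "Z = - X - Y" and P: "P = - (X * Y + Y * Z + Z * X)" and Q: "Q = X * Y * Z"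
      using s1 s2 s3 unfolding XYZ by (simp_all add: complex_eq_iff)
    show ?thesis
      unfolding D_def P Q Z by (simp add: algebra_simps power2_eq_square power3_eq_cube)
  qed
  then have "D = - 27 + 108 * \<kappa> * (\<kappa>^2 + \<tau>) - 324 * \<kappa>^4 * \<tau> - 72 * \<kappa>^2 * \<tau>^2 - 4 * \<tau>^3"
    unfolding P_def Q_def
    by (simp add: algebra_simps power2_eq_square power3_eq_cube power4_eq_xxxx)
  ultimately show ?thesis by blast
qed

end
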